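(* Let $m=(m_0,m_1,\ldots)$ be a sequence of integers with $m_k\ge 2$ for all $k$, let $G_m$ be the associated Vilenkin group with normalized Haar measure $\mu$, and let $1\le p<\infty$. If $E\subseteq G_m$ is a set of measure zero (i.e. $\mu(E)=0$), then there exists a function $f\in L_p(G_m)$ such that the Fejér means $(\sigma_n f)_{n\ge 1}$ of $f$ with respect to the Vilenkin system diverge on $E$; that is, for every $x\in E$ the sequence of complex numbers $(\sigma_n f(x))_{n\ge 1}$ does not converge as $n\to\infty$.
   Context: Write $\mathbb{N}_+=\{1,2,\ldots\}$ and $\mathbb{N}=\mathbb{N}_+\cup\{0\}$. Let $m=(m_0,m_1,\ldots)$ be a sequence of integers $m_k\ge 2$, and let $Z_{m_k}=\{0,1,\ldots,m_k-1\}$ be the additive group of integers modulo $m_k$, with the discrete topology. The Vilenkin group $G_m$ is the complete direct product $\prod_{k\in\mathbb{N}}Z_{m_k}$ with the product topology and coordinatewise addition; its elements are sequences $x=(x_0,x_1,\ldots)$ with $x_k\in Z_{m_k}$. The measure $\mu$ is the product of the uniform probability measures $\mu_k(\{j\})=1/m_k$ on $Z_{m_k}$; it is the Haar measure on $G_m$ with $\mu(G_m)=1$. $L_p(G_m)$ is the space of complex-valued functions on $G_m$ with $\int_{G_m}|f|^p\,d\mu<\infty$. Generalized number system: $M_0=1$, $M_{k+1}=m_kM_k$ for $k\in\mathbb{N}$. Every $n\in\mathbb{N}$ is uniquely written $n=\sum_{j=0}^\infty n_jM_j$ with $n_j\in Z_{m_j}$, only finitely many $n_j$ being nonzero. Generalized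 Rademacher functions: $r_k(x)=\exp(2\pi i\,x_k/m_k)$ for $x\in G_m$, $k\in\mathbb{N}$. The Vilenkin system is $(\psi_n)_{n\in\mathbb{N}}$ with $\psi_n(x)=\prod_{k=0}^\infty r_k(x)^{n_k}$. For $f\in L_1(G_m)$, the Vilenkin-Fourier coefficients are $\widehat f(n)=\int_{G_m}f\,\overline{\psi_n}\,d\mu$ ($n\in\mathbb{N}$), the partial sums are $S_nf=\sum_{k=0}^{n-1}\widehat f(k)\psi_k$ ($n\in\mathbb{N}_+$), and the Fejér means are $$\sigma_nf=\frac1n\sum_{k=1}^{n}S_kf=\sum_{k=0}^{n-1}\Bigl(1-\frac kn\Bigr)\widehat f(k)\psi_k\qquad(n\in\mathbb{N}_+).$$ Since $\mu(G_m)=1$, $L_p(G_m)\subseteq L_1(G_m)$ for $p\ge1$, so these are defined for $f\in L_p(G_m)$; each $\sigma_nf$ is a finite linear combination of the functions $\psi_k$ and hence is defined at every point of $G_m$. *)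

theory Defs
  imports "HOL-Probability.Probability"
begin

definition vilenkin_group :: "(nat \<Rightarrow> nat) \<Rightarrow> (nat \<Rightarrow> nat) set" where
  "vilenkin_group m = (\<Pi>\<^sub>E k\<in>UNIV. {..<m k})"

text \<open>
  The sigma-algebra is the product sigma-algebra. Since the topology on the group is a countable
  product of finite discrete spaces, this is its Borel sigma-algebra.
\<close>

definition vilenkin_measure :: "(nat \<Rightarrow> nat) \<Rightarrow> (nat \<Rightarrow> nat) measure" where
  "vilenkin_measure m = (\<Pi>\<^sub>M k\<in>UNIV. uniform_count_measure {..<m k})"

lemma space_vilenkin_measure: "space (vilenkin_measure m) = vilenkin_group m"
  by (simp add: vilenkin_measure_def vilenkin_group_def space_PiM space_uniform_count_measure)

lemma prob_space_vilenkin_measure: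
  assumes "\<And>k. m k \<ge> 2"
  shows "prob_space (vilenkin_measure m)"
  unfolding vilenkin_measure_def
proof (intro prob_space_PiM prob_space_uniform_count_measure)
  fix k
  have "0 \<in> {..<m k}"
    using assms[of k] by simp
  then show "{..<m k} \<noteq> {}"
    by blast
qed auto

text \<open>
  Elements of \<open>L\<^sub>p\<close> are actual functions, not classes modulo null sets;
  their values outside \<^term>\<open>vilenkin_group m\<close> are irrelevant.
\<close>

definition vilenkin_Lp :: "(nat \<Rightarrow> nat) \<Rightarrow> real \<Rightarrow> ((nat \<Rightarrow> nat) \<Rightarrow> complex) set" where
  "vilenkin_Lp m p = {f \<in> borel_measurable (vilenkin_measure m).
     integrable (vilenkin_measure m) (\<lambda>x. cmod (f x) powr p)}"

definition gen_base :: "(nat \<Rightarrow> nat) \<Rightarrow> nat \<Rightarrow> nat" where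
  "gen_base m k = (\<Prod>j<k. m j)"

lemma gen_base_0: "gen_base m 0 = 1"
  and gen_base_Suc: "gen_base m (Suc k) = m k * gen_base m k"
  by (simp_all add: gen_base_def)

definition gen_digit :: "(nat \<Rightarrow> nat) \<Rightarrow> nat \<Rightarrow> nat \<Rightarrow> nat" where
  "gen_digit m n k = n div gen_base m k mod m k"

text \<open>
  The following lemmas show that \<^term>\<open>gen_digit m n\<close> is the unique sequence of digits
  \<open>n\<^sub>j < m\<^sub>j\<close>, almost all zero, with \<open>n = (\<Sum>j. n\<^sub>j M\<^sub>j)\<close>.
\<close>

lemma gen_digit_less:
  assumes "\<And>k. m k \<ge> 2"
  shows "gen_digit m n k < m k"
  using assms[of k] by (simp add: gen_digit_def)

lemma less_gen_base:
  assumes "\<And>k. m k \<ge> 2"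
  shows "k < gen_base m k"
proof (induction k)
  case (Suc k)
  have "Suc k < 2 * gen_base m k"
    using Suc by simp
  also have "\<dots> \<le> m k * gen_base m k"
    using assms by (intro mult_right_mono) auto
  finally show ?case by (simp add: gen_base_Suc)
qed (simp add: gen_base_0)

lemma finite_gen_digit:
  assumes "\<And>k. m k \<ge> 2"
  shows "finite {k. gen_digit m n k \<noteq> 0}"
proof (rule finite_subset)
  show "{k. gen_digit m n k \<noteq> 0} \<subseteq> {..<n}"
  proof
    fix k assume k: "k \<in> {k. gen_digit m n k \<noteq> 0}"
    have "k < gen_base m k"
      using assms by (rule less_gen_base)
    moreover have "\<not> n < gen_base m k"
      using k by (auto simp: gen_digit_def)
    ultimately show "k \<in> {..<n}"
      by simp
  qed
qed simp

lemma sum_gen_digit_lessThan: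
  "(\<Sum>j<k. gen_digit m n j * gen_base m j) = n mod gen_base m k"
proof (induction k)
  case (Suc k)
  then show ?case
    using mod_mult2_eq[of n "gen_base m k" "m k"]
    by (simp add: gen_base_Suc gen_digit_def mult.commute)
qed (simp add: gen_base_0)

lemma sum_gen_digit:
  assumes "\<And>k. m k \<ge> 2"
  shows "n = (\<Sum>j | gen_digit m n j \<noteq> 0. gen_digit m n j * gen_base m j)"
proof -
  have nz: "j < n" if "gen_digit m n j \<noteq> 0" for j
  proof (rule ccontr)
    assume "\<not> j < n"
    then have "n < gen_base m j"
      using less_gen_base[of m j, OF assms] by linarith
    with that show False
      by (simp add: gen_digit_def)
  qed
  have "n = (\<Sum>j<n. gen_digit m n j * gen_base m j)"
    using less_gen_base[of m n, OF assms] by (simp add: sum_gen_digit_lessThan)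
  also have "\<dots> = (\<Sum>j | gen_digit m n j \<noteq> 0. gen_digit m n j * gen_base m j)"
  proof (rule sum.mono_neutral_right)
    show "{j. gen_digit m n j \<noteq> 0} \<subseteq> {..<n}"
      using nz by blast
  qed auto
  finally show ?thesis .
qed

lemma gen_digit_unique:
  assumes m: "\<And>k. m k \<ge> 2"
    and d: "\<And>j. d j < m j" and fin: "finite {j. d j \<noteq> 0}"
    and n: "n = (\<Sum>j | d j \<noteq> 0. d j * gen_base m j)"
  shows "gen_digit m n = d"
proof
  fix k
  have bound: "(\<Sum>j<k. d j * gen_base m j) < gen_base m k" for k
  proof (induction k)
    case (Suc k)
    have "(\<Sum>j<Suc k. d j * gen_base m j) < Suc (d k) * gen_base m k"
      using Suc by simp
    also have "\<dots> \<le> m k * gen_base m k"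
      using d[of k] by (intro mult_right_mono) auto
    finally show ?case by (simp add: gen_base_Suc)
  qed (simp add: gen_base_0)
  let ?low = "\<Sum>j<k. d j * gen_base m j"
  obtain N where N: "{j. d j \<noteq> 0} \<subseteq> {..<N}"
    using fin finite_nat_iff_bounded by blast
  define L where "L = max N (Suc k)"
  have "n = (\<Sum>j<L. d j * gen_base m j)"
    unfolding n by (rule sum.mono_neutral_left) (use N in \<open>auto simp: L_def\<close>)
  also have "{..<L} = {..<Suc k} \<union> {Suc k..<L}"
    by (auto simp: L_def)
  also have "(\<Sum>j\<in>\<dots>. d j * gen_base m j) =
      (\<Sum>j<Suc k. d j * gen_base m j) + (\<Sum>j\<in>{Suc k..<L}. d j * gen_base m j)"
    by (rule sum.union_disjoint) auto
  finally have split: "n = ?low + d k * gen_base m k + (\<Sum>j\<in>{Suc k..<L}. d j * gen_base m j)"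
    by simp
  have "gen_base m (Suc k) dvd (\<Sum>j\<in>{Suc k..<L}. d j * gen_base m j)"
    unfolding gen_base_def by (intro dvd_sum dvd_mult prod_dvd_prod_subset) auto
  then obtain q where "(\<Sum>j\<in>{Suc k..<L}. d j * gen_base m j) = m k * gen_base m k * q"
    by (auto simp: gen_base_Suc)
  with split have "n = ?low + gen_base m k * (d k + m k * q)"
    by (simp add: algebra_simps)
  moreover have "gen_base m k > 0"
    using less_gen_base[of m k, OF m] by simp
  ultimately have "n div gen_base m k = d k + m k * q"
    using bound[of k] by simp
  then show "gen_digit m n k = d k"
    using d[of k] by (simp add: gen_digit_def)
qed

definition gen_rademacher :: "(nat \<Rightarrow> nat) \<Rightarrow> nat \<Rightarrow> (nat \<Rightarrow> nat) \<Rightarrow> complex" where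
  "gen_rademacher m k x = exp (2 * of_real pi * \<i> * of_nat (x k) / of_nat (m k))"

definition vilenkin_fun :: "(nat \<Rightarrow> nat) \<Rightarrow> nat \<Rightarrow> (nat \<Rightarrow> nat) \<Rightarrow> complex" where
  "vilenkin_fun m n x = (\<Prod>k | gen_digit m n k \<noteq> 0. gen_rademacher m k x ^ gen_digit m n k)"

definition vilenkin_coeff :: "(nat \<Rightarrow> nat) \<Rightarrow> ((nat \<Rightarrow> nat) \<Rightarrow> complex) \<Rightarrow> nat \<Rightarrow> complex" where
  "vilenkin_coeff m f n = (LINT x|vilenkin_measure m. f x * cnj (vilenkin_fun m n x))"

definition vilenkin_partial_sum ::
    "(nat \<Rightarrow> nat) \<Rightarrow> nat \<Rightarrow> ((nat \<Rightarrow> nat) \<Rightarrow> complex) \<Rightarrow> (nat \<Rightarrow> nat) \<Rightarrow> complex" where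
  "vilenkin_partial_sum m n f x = (\<Sum>k<n. vilenkin_coeff m f k * vilenkin_fun m k x)"

definition vilenkin_fejer ::
    "(nat \<Rightarrow> nat) \<Rightarrow> nat \<Rightarrow> ((nat \<Rightarrow> nat) \<Rightarrow> complex) \<Rightarrow> (nat \<Rightarrow> nat) \<Rightarrow> complex" where
  "vilenkin_fejer m n f x = 1 / of_nat n * (\<Sum>k=1..n. vilenkin_partial_sum m k f x)"

end

theory Submission imports Defs begin

text \<open>
  The function \<open>f\<close> is a lacunary series of modulated indicator functions,
  \<open>f = (\<Sum>k. r\<^bsub>N k\<^esub> * 1\<^bsub>U k\<^esub>)\<close>,
  where \<open>r\<^sub>j\<close> is a Rademacher function and \<open>U k\<close> is a set that depends only on
  the first \<open>N k\<close> coordinates.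

  A null set can be covered by countably many such cylinder sets of arbitrarily small total
  measure. Collecting the members of infinitely many of these covers into finite groups gives sets
  \<open>U k\<close> whose measures decay as fast as desired, while every point of the null set lies
  in infinitely many of them (\<open>null_set_thin_limsup_cover\<close>). The fast decay puts
  \<open>f\<close> into \<open>L\<^sub>p\<close> (\<open>thin_series_Lp\<close>) and allows its Fourier coefficients
  to be computed term by term (\<open>vilenkin_coeff_sums\<close>).

  Write \<open>L k\<close> for \<open>gen_base m (N k)\<close>. The indicator function of \<open>U k\<close> is a Vilenkin
  polynomial of degree below \<open>L k\<close>. The Rademacher function with index \<open>N k\<close> is the Vilenkin
  function with index \<open>L k\<close>, and multiplication by it shifts the spectrum into
  \<open>[L k, 2 * L k)\<close> (\<open>rademacher_cylinder_expansion\<close>). If \<open>N k + 2 \<le> N (k + 1)\<close> and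
  \<open>e = 2 * L k\<close>, then \<open>f\<close> has no frequencies in \<open>[e, 2 * e)\<close>. Hence all partial sums
  \<open>S\<^sub>n f\<close> with \<open>e < n \<le> 2 * e\<close> coincide, and their common value is twice the Fejer mean
  of order \<open>2 * e\<close> minus the one of order \<open>e\<close> (\<open>partial_sum_from_fejer\<close>).
  If the Fejer means converged at a point \<open>x\<close>, then so would these partial sums, which are
  the partial sums of the series defining \<open>f x\<close>. But its terms have modulus one whenever
  \<open>x \<in> U k\<close>, hence do not tend to zero when this happens infinitely often
  (\<open>fejer_diverges_of_lacunary_blocks\<close>).
\<close>

section \<open>Covering null sets by sets of an algebra\<close>

text \<open>
  By the extension theorem of Caratheodory, the outer measure that countable covers from
  \<open>\<A>\<close> induce is a measure on the generated sigma-algebra. It agrees with \<open>N\<close> on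
  \<open>\<A>\<close>, hence everywhere, so a null set has covers of arbitrarily small total measure.
\<close>

lemma null_set_algebra_cover:
  fixes N :: "'a measure" and e :: ennreal
  assumes fin: "finite_measure N" and alg: "algebra (space N) \<A>"
    and gen: "sets N = sigma_sets (space N) \<A>"
    and X: "X \<in> null_sets N" and e: "e > 0"
  shows "\<exists>A. range A \<subseteq> \<A> \<and> X \<subseteq> (\<Union>i::nat. A i) \<and> (\<Sum>i. emeasure N (A i)) < e"
proof -
  interpret finite_measure N by (rule fin)
  interpret \<A>: algebra "space N" \<A> by (rule alg)
  have sub: "\<A> \<subseteq> sets N" unfolding gen by (rule sigma_sets_superset_generator)
  have pos: "positive \<A> (emeasure N)" by (simp add: positive_def)
  have ca: "countably_additive \<A> (emeasure N)"
    using sub by (auto simp: countably_additive_def intro!: suminf_emeasure)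
  have inc: "increasing \<A> (emeasure N)"
    using \<A>.additive_increasing[OF pos] \<A>.countably_additive_additive[OF pos ca] by blast
  define outer where "outer = outer_measure \<A> (emeasure N)"
  define ls where "ls = lambda_system (space N) (Pow (space N)) outer"
  have mls: "measure_space (space N) ls outer"
    using sigma_algebra.caratheodory_lemma
            [OF sigma_algebra_Pow \<A>.outer_measure_space_outer_measure [OF pos inc]]
    by (simp add: ls_def outer_def)
  then have "sigma_algebra (space N) ls" by (simp add: measure_space_def)
  moreover have "\<A> \<subseteq> ls"
    unfolding ls_def outer_def
    by (rule \<A>.algebra_subset_lambda_system[OF pos inc \<A>.countably_additive_additive[OF pos ca]])
  ultimately have "sets N \<subseteq> ls"
    unfolding gen by (rule sigma_algebra.sigma_sets_subset)
  then have m_outer: "measure_space (space N) (sets N) outer"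
    using mls sets.sigma_algebra_axioms by (rule measure_down[rotated 2])
  have "N = measure_of (space N) (sets N) outer"
  proof (rule measure_eqI_generator_eq[of \<A> "space N" _ _ "\<lambda>_. space N"])
    show "emeasure N A = emeasure (measure_of (space N) (sets N) outer) A" if "A \<in> \<A>" for A
      using m_outer that sub \<A>.outer_measure_agrees[OF pos ca that]
      by (subst emeasure_measure_of_sigma) (auto simp: measure_space_def outer_def)
    show "sets (measure_of (space N) (sets N) outer) = sigma_sets (space N) \<A>"
      by (simp only: sets.sets_measure_of_eq gen[symmetric])
  qed (use \<A>.Int_stable \<A>.space_closed gen in auto)
  moreover have "emeasure (measure_of (space N) (sets N) outer) X = outer X"
    using m_outer X by (intro emeasure_measure_of_sigma) (auto simp: measure_space_def)
  ultimately have "outer_measure \<A> (emeasure N) X < e" using X e by (auto simp: outer_def)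
  from \<A>.outer_measure_close[OF this] show ?thesis by auto
qed

text \<open>
  Enumerating covers of total measure at most \<open>2\<^sup>-\<^sup>j\<close>, one for each \<open>j\<close>, in a single
  sequence gives a convergent sum of measures. Cutting the sequence into consecutive finite groups
  whose tails are below \<open>\<epsilon> k\<close> yields \<open>U k\<close>. Because the groups are finite, a point that lies
  in infinitely many members of the sequence also lies in infinitely many groups.
\<close>

lemma null_set_thin_limsup_cover:
  fixes N :: "'a measure" and \<epsilon> :: "nat \<Rightarrow> real"
  assumes fin: "finite_measure N" and alg: "algebra (space N) \<A>"
    and gen: "sets N = sigma_sets (space N) \<A>"
    and X: "X \<in> null_sets N" and \<epsilon>: "\<And>k. \<epsilon> k > 0"
  shows "\<exists>U. (\<forall>k. U k \<in> \<A> \<and> measure N (U k) \<le> \<epsilon> k) \<and> (\<forall>x\<in>X. \<exists>\<^sub>\<infinity>k. x \<in> U k)"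
proof -
  interpret finite_measure N by (rule fin)
  interpret \<A>: algebra "space N" \<A> by (rule alg)
  have sub: "A \<in> sets N" if "A \<in> \<A>" for A
    using that unfolding gen by (rule sigma_sets.Basic)
  have "\<forall>j. \<exists>A. range A \<subseteq> \<A> \<and> X \<subseteq> (\<Union>i::nat. A i) \<and> (\<Sum>i. emeasure N (A i)) < ennreal ((1/2) ^ j)"
    by (intro allI null_set_algebra_cover[OF fin alg gen X]) simp
  then obtain A where A: "\<And>j. range (A j) \<subseteq> \<A>" "\<And>j. X \<subseteq> (\<Union>i::nat. A j i)"
      "\<And>j. (\<Sum>i. emeasure N (A j i)) < ennreal ((1/2) ^ j)"
    by metis
  define B where "B n = case_prod A (prod_decode n)" for n
  have B: "B n \<in> \<A>" for n using A(1) by (auto simp: B_def split: prod.split)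
  have "(\<Sum>n. emeasure N (B n)) = (\<Sum>j. \<Sum>i. emeasure N (A j i))"
    unfolding B_def by (intro suminf_ennreal_2dimen[where f = "\<lambda>q. emeasure N (case_prod A q)"]) simp
  also have "\<dots> \<le> (\<Sum>j. ennreal ((1/2) ^ j))"
    using A(3) by (intro suminf_le) (auto intro: less_imp_le)
  also have "\<dots> < \<infinity>"
    by (subst suminf_ennreal2) (auto intro: summable_geometric)
  finally have "(\<Sum>n. ennreal (measure N (B n))) < \<infinity>"
    by (simp add: emeasure_eq_measure)
  then have sumB: "summable (\<lambda>n. measure N (B n))"
    by (intro summable_suminf_not_top) auto
  have inf: "\<exists>n\<ge>n0. x \<in> B n" if x: "x \<in> X" for x n0
  proof -
    have "\<forall>j. \<exists>i. x \<in> A j i"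
    proof
      fix j show "\<exists>i. x \<in> A j i" using subsetD[OF A(2) x, of j] by auto
    qed
    then obtain i where i: "\<And>j. x \<in> A j (i j)" by metis
    \<comment> \<open>each of the infinitely many covers contributes its own member containing \<open>x\<close>\<close>
    have "inj (\<lambda>j. prod_encode (j, i j))" by (auto simp: inj_def)
    then have "infinite (range (\<lambda>j. prod_encode (j, i j)))" by (rule range_inj_infinite)
    then obtain j where "prod_encode (j, i j) > n0"
      unfolding infinite_nat_iff_unbounded by blast
    then show ?thesis using i[of j] by (intro exI[of _ "prod_encode (j, i j)"]) (auto simp: B_def)
  qed
  have "\<exists>n>n0. (\<Sum>i. measure N (B (i + n))) < \<epsilon> k" for n0 k
  proof -
    have "eventually (\<lambda>n. (\<Sum>i. measure N (B (i + n))) < \<epsilon> k) sequentially"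
      using suminf_exist_split2[OF sumB] \<epsilon> by (rule order_tendstoD)
    then show ?thesis
      using eventually_conj[OF _ eventually_gt_at_top[of n0]] eventually_happens'[OF sequentially_bot]
      by blast
  qed
  then have "\<exists>r. \<forall>k. (\<Sum>i. measure N (B (i + r k))) < \<epsilon> k \<and> r k < r (Suc k)"
    by (intro dependent_nat_choice) auto
  then obtain r where r: "\<And>k. (\<Sum>i. measure N (B (i + r k))) < \<epsilon> k" and r_less: "\<And>k. r k < r (Suc k)"
    by blast
  have smr: "strict_mono r" using r_less by (simp add: strict_mono_Suc_iff)
  define U where "U k = (\<Union>n\<in>{r k..<r (Suc k)}. B n)" for k
  have "U k \<in> \<A>" for k unfolding U_def using B by (intro \<A>.finite_UN) auto
  moreover have "measure N (U k) \<le> \<epsilon> k" for k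
  proof -
    have "measure N (U k) \<le> (\<Sum>n\<in>{r k..<r (Suc k)}. measure N (B n))"
      unfolding U_def using sub B by (intro measure_UNION_le) auto
    also have "\<dots> = (\<Sum>i<r (Suc k) - r k. measure N (B (i + r k)))"
      using sum.shift_bounds_nat_ivl[of "\<lambda>n. measure N (B n)" 0 "r k" "r (Suc k) - r k"] r_less[of k]
      by (simp add: atLeast0LessThan)
    also have "\<dots> \<le> (\<Sum>i. measure N (B (i + r k)))"
      by (intro sum_le_suminf) (auto simp: sumB summable_iff_shift[of "\<lambda>n. measure N (B n)"])
    finally show ?thesis using r[of k] by simp
  qed
  moreover have "\<exists>\<^sub>\<infinity>k. x \<in> U k" if x: "x \<in> X" for x
    unfolding INFM_nat_le
  proof
    fix k0
    obtain n where n: "n \<ge> r k0" "x \<in> B n" using inf[OF x] by blast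
    \<comment> \<open>the group containing the index \<open>n\<close>\<close>
    define k where "k = (GREATEST k. r k \<le> n)"
    have bnd: "k \<le> n" if "r k \<le> n" for k
      using seq_suble[OF smr, of k] that by linarith
    have rk: "r k \<le> n" unfolding k_def by (rule GreatestI_nat[of "\<lambda>k. r k \<le> n", OF n(1) bnd])
    have "k0 \<le> k" unfolding k_def by (rule Greatest_le_nat[of "\<lambda>k. r k \<le> n", OF n(1) bnd])
    moreover have "n < r (Suc k)"
    proof (rule ccontr)
      assume "\<not> n < r (Suc k)"
      then have "r (Suc k) \<le> n" by (simp only: not_less)
      then have "Suc k \<le> k"
        unfolding k_def by (rule Greatest_le_nat[of "\<lambda>k. r k \<le> n"]) (rule bnd)
      then show False by simp
    qed
    ultimately show "\<exists>k\<ge>k0. x \<in> U k" using n(2) rk by (intro exI[of _ k]) (auto simp: U_def)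
  qed
  ultimately show ?thesis by blast
qed

section \<open>Cylinder sets of the Vilenkin group\<close>

text \<open>
  For varying \<open>N\<close> these are the finite unions of sets prescribing finitely many coordinates,
  equivalently the clopen subsets of the group.
\<close>

definition cylinder :: "(nat \<Rightarrow> nat) \<Rightarrow> nat \<Rightarrow> (nat \<Rightarrow> nat) set \<Rightarrow> bool" where
  "cylinder m N A \<longleftrightarrow> A \<subseteq> vilenkin_group m \<and>
     (\<forall>x\<in>vilenkin_group m. \<forall>y\<in>vilenkin_group m. (\<forall>k<N. x k = y k) \<longrightarrow> (x \<in> A \<longleftrightarrow> y \<in> A))"

lemma cylinder_subset: "cylinder m N A \<Longrightarrow> A \<subseteq> vilenkin_group m"
  unfolding cylinder_def by blast

lemma cylinder_cong:
  assumes "cylinder m N A" "x \<in> vilenkin_group m" "y \<in> vilenkin_group m" "\<And>k. k < N \<Longrightarrow> x k = y k"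
  shows "x \<in> A \<longleftrightarrow> y \<in> A"
  using bspec[OF bspec[OF conjunct2[OF assms(1)[unfolded cylinder_def]] assms(2)] assms(3)] assms(4) by blast

lemma cylinderI:
  assumes "A \<subseteq> vilenkin_group m"
    and "\<And>x y. x \<in> vilenkin_group m \<Longrightarrow> y \<in> vilenkin_group m \<Longrightarrow> (\<And>k. k < N \<Longrightarrow> x k = y k)
      \<Longrightarrow> x \<in> A \<longleftrightarrow> y \<in> A"
  shows "cylinder m N A"
  unfolding cylinder_def
proof (intro conjI ballI impI)
  fix x y assume "x \<in> vilenkin_group m" "y \<in> vilenkin_group m" "\<forall>k<N. x k = y k"
  then show "x \<in> A \<longleftrightarrow> y \<in> A" by (intro assms(2)) auto
qed (rule assms(1))

lemma cylinder_mono: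
  assumes A: "cylinder m N A" and N: "N \<le> N'"
  shows "cylinder m N' A"
proof (rule cylinderI[OF cylinder_subset[OF A]])
  fix x y assume "x \<in> vilenkin_group m" "y \<in> vilenkin_group m" "\<And>k. k < N' \<Longrightarrow> x k = y k"
  then show "x \<in> A \<longleftrightarrow> y \<in> A" using N by (intro cylinder_cong[OF A]) simp_all
qed

text \<open>
  Only finitely many initial segments of length \<open>N\<close> occur, so a cylinder set is a finite union of
  sets that prescribe the first \<open>N\<close> coordinates.
\<close>

lemma cylinder_measurable:
  assumes "cylinder m N A"
  shows "A \<in> sets (vilenkin_measure m)"
proof -
  let ?G = "vilenkin_group m" and ?R = "(\<lambda>x. restrict x {..<N}) ` A"
  define S where "S a = {x\<in>?G. \<forall>k<N. x k = a k}" for a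
  have AG: "A \<subseteq> ?G" using assms by (rule cylinder_subset)
  have "S a \<subseteq> A" if "a \<in> ?R" for a
  proof
    fix x assume x: "x \<in> S a"
    from \<open>a \<in> ?R\<close> obtain y where y: "y \<in> A" "a = restrict y {..<N}" by blast
    have "\<forall>k<N. x k = y k" "x \<in> ?G" using x y(2) by (simp_all add: S_def)
    then show "x \<in> A" using cylinder_cong[OF assms, of x y] y(1) AG by blast
  qed
  moreover have "x \<in> S (restrict x {..<N})" if "x \<in> A" for x
    using that AG by (auto simp: S_def)
  ultimately have "A = (\<Union>a\<in>?R. S a)" by blast
  moreover have "?R \<subseteq> (\<Pi>\<^sub>E k\<in>{..<N}. {..<m k})"
    using AG by (intro image_subsetI) (auto simp: vilenkin_group_def)
  then have "finite ?R"
    by (rule finite_subset) (auto intro: finite_PiE)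
  moreover have "S a \<in> sets (vilenkin_measure m)" for a
  proof -
    have "{x\<in>space (vilenkin_measure m). x k = a k} \<in> sets (vilenkin_measure m)" for k
    proof -
      have "(\<lambda>x. x k) \<in> measurable (vilenkin_measure m) (uniform_count_measure {..<m k})"
        unfolding vilenkin_measure_def by (rule measurable_component_singleton) simp
      then have "(\<lambda>x. x k) -` ({..<m k} \<inter> {a k}) \<inter> space (vilenkin_measure m) \<in> sets (vilenkin_measure m)"
        by (rule measurable_sets) (simp add: sets_uniform_count_measure)
      also have "(\<lambda>x. x k) -` ({..<m k} \<inter> {a k}) \<inter> space (vilenkin_measure m)
          = {x\<in>space (vilenkin_measure m). x k = a k}"
        by (auto simp: space_vilenkin_measure vilenkin_group_def)
      finally show ?thesis .
    qed
    then have "{x\<in>space (vilenkin_measure m). \<forall>k\<in>{..<N}. x k = a k} \<in> sets (vilenkin_measure m)"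
      by (intro sets.sets_Collect_finite_All) auto
    also have "{x\<in>space (vilenkin_measure m). \<forall>k\<in>{..<N}. x k = a k} = S a"
      by (auto simp: S_def space_vilenkin_measure)
    finally show ?thesis .
  qed
  ultimately show ?thesis by (metis sets.finite_UN)
qed

lemma algebra_cylinder: "algebra (vilenkin_group m) {A. \<exists>N. cylinder m N A}"
  unfolding algebra_iff_Un
proof (intro conjI ballI)
  fix A assume "A \<in> {A. \<exists>N. cylinder m N A}"
  then obtain N where "cylinder m N A" by blast
  then have "cylinder m N (vilenkin_group m - A)"
    using cylinder_cong by (intro cylinderI) blast+
  then show "vilenkin_group m - A \<in> {A. \<exists>N. cylinder m N A}" by blast
next
  fix A B assume "A \<in> {A. \<exists>N. cylinder m N A}" "B \<in> {A. \<exists>N. cylinder m N A}"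
  then obtain N1 N2 where "cylinder m N1 A" "cylinder m N2 B" by blast
  then have A: "cylinder m (max N1 N2) A" and B: "cylinder m (max N1 N2) B"
    by (blast intro: cylinder_mono max.cobounded1 max.cobounded2)+
  have "cylinder m (max N1 N2) (A \<union> B)"
  proof (rule cylinderI)
    show "A \<union> B \<subseteq> vilenkin_group m" using cylinder_subset[OF A] cylinder_subset[OF B] by blast
    fix x y assume "x \<in> vilenkin_group m" "y \<in> vilenkin_group m" "\<And>k. k < max N1 N2 \<Longrightarrow> x k = y k"
    then show "x \<in> A \<union> B \<longleftrightarrow> y \<in> A \<union> B"
      using cylinder_cong[OF A, of x y] cylinder_cong[OF B, of x y] by blast
  qed
  then show "A \<union> B \<in> {A. \<exists>N. cylinder m N A}" by blast
next
  show "{} \<in> {A. \<exists>N. cylinder m N A}" using cylinderI[of "{}" m 0] by auto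
  show "{A. \<exists>N. cylinder m N A} \<subseteq> Pow (vilenkin_group m)" using cylinder_subset by blast
qed

lemma sets_vilenkin_measure:
  "sets (vilenkin_measure m) = sigma_sets (vilenkin_group m) {A. \<exists>N. cylinder m N A}"
proof
  let ?G = "vilenkin_group m"
  show "sets (vilenkin_measure m) \<subseteq> sigma_sets ?G {A. \<exists>N. cylinder m N A}"
    unfolding vilenkin_measure_def sets_PiM_single space_uniform_count_measure vilenkin_group_def[symmetric]
  proof (rule sigma_sets_mono, safe)
    fix i A
    have "cylinder m (Suc i) {f \<in> ?G. f i \<in> A}"
      by (rule cylinderI) auto
    then show "{f \<in> ?G. f i \<in> A} \<in> sigma_sets ?G {A. \<exists>N. cylinder m N A}"
      by (intro sigma_sets.Basic) auto
  qed
  show "sigma_sets ?G {A. \<exists>N. cylinder m N A} \<subseteq> sets (vilenkin_measure m)"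
    using cylinder_measurable
    by (intro sets.sigma_sets_subset[of _ "vilenkin_measure m", unfolded space_vilenkin_measure]) auto
qed

section \<open>Series of bounded functions on small sets\<close>

text \<open>
  By the Borel-Cantelli lemma almost every \<open>x\<close> lies in only finitely many sets \<open>U k\<close>. If \<open>K\<close> is the
  last index with \<open>x \<in> U K\<close>, the series has at most \<open>K + 1\<close> nonzero terms, so the \<open>p\<close>-th power of its
  modulus is at most \<open>(K + 1)\<^sup>p\<close>, hence at most the sum of \<open>(k + 1)\<^sup>p\<close> over all \<open>k\<close> with \<open>x \<in> U k\<close>.
  The bound on the measures makes this majorant integrable.
\<close>

lemma thin_series_Lp:
  fixes P :: "nat \<Rightarrow> 'a \<Rightarrow> complex" and p :: real
  assumes "finite_measure M" and p: "p \<ge> 0"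
    and U: "\<And>k. U k \<in> sets M"
    and small: "\<And>k. measure M (U k) \<le> (1/2) ^ k / (real k + 1) powr p"
    and P [measurable]: "\<And>k. P k \<in> borel_measurable M"
    and bound: "\<And>k x. cmod (P k x) \<le> indicator (U k) x"
  shows "\<And>k. integrable M (P k)"
    and "AE x in M. summable (\<lambda>k. norm (P k x))"
    and "summable (\<lambda>k. LINT x|M. norm (P k x))"
    and "(\<lambda>x. \<Sum>k. P k x) \<in> borel_measurable M"
    and "integrable M (\<lambda>x. cmod (\<Sum>k. P k x) powr p)"
proof -
  interpret finite_measure M by fact
  have U_int: "integrable M (\<lambda>x. indicator (U k) x :: real)" for k
    using U by (simp add: integrable_indicator_iff emeasure_finite less_top[symmetric])
  have one: "1 \<le> (real k + 1) powr p" for k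
    using p by (simp add: ge_one_powr_ge_zero)
  have small': "measure M (U k) \<le> (1/2) ^ k" for k
  proof -
    have "(1/2) ^ k / (real k + 1) powr p \<le> (1/2) ^ k / 1"
      using one[of k] by (intro divide_left_mono) auto
    then show ?thesis using small[of k] by simp
  qed
  have sumU: "summable (\<lambda>k. measure M (U k))"
    by (rule summable_comparison_test'[of "\<lambda>k. (1/2) ^ k" 0]) (use small' in \<open>auto intro: summable_geometric\<close>)
  have fin: "AE x in M. finite {k. x \<in> U k}"
  proof -
    have "AE x in M. eventually (\<lambda>n. x \<in> space M - U n) sequentially"
      using U sumU by (intro borel_cantelli_AE1) (auto simp: emeasure_finite less_top[symmetric])
    then show ?thesis
    proof eventually_elim
      case (elim x)
      then obtain n0 where "\<And>n. n \<ge> n0 \<Longrightarrow> x \<notin> U n" by (auto simp: eventually_sequentially)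
      then have "{k. x \<in> U k} \<subseteq> {..<n0}" using not_le by blast
      then show ?case by (rule finite_subset) simp
    qed
  qed
  have P0: "P k x = 0" if "x \<notin> U k" for k x using bound[of k x] that by simp
  show P_int: "integrable M (P k)" for k
    by (rule Bochner_Integration.integrable_bound[OF U_int[of k]]) (use bound in auto)
  show P_AE: "AE x in M. summable (\<lambda>k. norm (P k x))"
    using fin by eventually_elim (rule summable_finite, assumption, simp add: P0)
  show P_sum: "summable (\<lambda>k. LINT x|M. norm (P k x))"
  proof (rule summable_comparison_test'[OF sumU, of 0])
    fix k
    have "(LINT x|M. norm (P k x)) \<le> (LINT x|M. indicator (U k) x)"
      using P_int U_int bound by (intro integral_mono) auto
    then show "norm (LINT x|M. norm (P k x)) \<le> measure M (U k)"
      using U sets.sets_into_space[OF U[of k]] by (simp add: Int_absorb2)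
  qed
  show meas: "(\<lambda>x. \<Sum>k. P k x) \<in> borel_measurable M" by measurable
  define W where "W k x = (real k + 1) powr p * indicator (U k) x" for k x
  have W_int: "integrable M (\<lambda>x. \<Sum>k. W k x)"
  proof (rule integrable_suminf)
    show "integrable M (W k)" for k unfolding W_def using U_int by simp
    show "AE x in M. summable (\<lambda>k. norm (W k x))"
      using fin
        by eventually_elim (rule summable_finite, auto simp: W_def indicator_def)
    show "summable (\<lambda>k. LINT x|M. norm (W k x))"
    proof (rule summable_comparison_test'[of "\<lambda>k. (1/2) ^ k" 0])
      fix k
      have "(LINT x|M. norm (W k x)) = (real k + 1) powr p * measure M (U k)"
        using U sets.sets_into_space[OF U[of k]] by (simp add: W_def abs_mult Int_absorb2)
      also have "\<dots> \<le> (1/2) ^ k"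
        using small[of k] one[of k] by (simp add: field_simps)
      finally show "norm (LINT x|M. norm (W k x)) \<le> (1/2) ^ k" by simp
    qed (auto intro: summable_geometric)
  qed
  show "integrable M (\<lambda>x. cmod (\<Sum>k. P k x) powr p)"
  proof (rule Bochner_Integration.integrable_bound[OF W_int])
    show "AE x in M. norm (cmod (\<Sum>k. P k x) powr p) \<le> norm (\<Sum>k. W k x)"
      using fin
    proof eventually_elim
      case (elim x)
      define D where "D = {k. x \<in> U k}"
      have D: "finite D" using elim by (simp add: D_def)
      have P_eq: "(\<Sum>k. P k x) = (\<Sum>k\<in>D. P k x)"
        using D by (intro suminf_finite) (auto simp: D_def P0)
      have W_eq: "(\<Sum>k. W k x) = (\<Sum>k\<in>D. W k x)"
        using D by (intro suminf_finite) (auto simp: D_def W_def)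
      show ?case
      proof (cases "D = {}")
        case False
        define K where "K = Max D"
        have K: "K \<in> D" using D False by (simp add: K_def)
        have "D \<subseteq> {..K}" using D by (auto simp: K_def)
        then have "card D \<le> K + 1" using card_mono[of "{..K}" D] by simp
        then have card: "real (card D) \<le> real K + 1" by linarith
        have "cmod (\<Sum>k. P k x) \<le> (\<Sum>k\<in>D. cmod (P k x))"
          unfolding P_eq by (rule norm_sum)
        also have "\<dots> \<le> (\<Sum>k\<in>D. 1)"
          using bound by (intro sum_mono order_trans[OF bound]) (auto simp: indicator_def)
        finally have "cmod (\<Sum>k. P k x) \<le> real K + 1" using card by simp
        then have "cmod (\<Sum>k. P k x) powr p \<le> (real K + 1) powr p"
          using p by (intro powr_mono2) auto
        also have "\<dots> = W K x" using K by (simp add: W_def D_def)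
        also have "\<dots> \<le> (\<Sum>k\<in>D. W k x)"
          using D K by (intro member_le_sum) (auto simp: W_def)
        finally show ?thesis by (simp add: W_eq)
      qed (simp add: P_eq W_eq)
    qed
  qed (use meas in measurable)
qed

section \<open>Vilenkin functions\<close>

lemma rademacher_power_eq_cis:
  "gen_rademacher m k x ^ j = cis (2 * pi * real (j * x k) / real (m k))"
proof -
  have "gen_rademacher m k x = cis (2 * pi * real (x k) / real (m k))"
    by (simp add: gen_rademacher_def cis_conv_exp algebra_simps)
  then show ?thesis
    by (simp add: Complex.DeMoivre algebra_simps)
qed

lemma norm_gen_rademacher [simp]: "cmod (gen_rademacher m k x) = 1"
  using rademacher_power_eq_cis[of m k x 1] by simp

text \<open>
  Orthogonality of the characters of \<open>Z\<^sub>m\<close>; it serves both for the integrals of products of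
  Vilenkin functions and for expanding a function of one coordinate.
\<close>

lemma sum_cis_period:
  fixes m :: nat and d :: int
  assumes "m > 0"
  shows "(\<Sum>t<m. cis (2 * pi * of_int (d * int t) / real m)) = (if int m dvd d then of_nat m else 0)"
proof -
  define w where "w = cis (2 * pi * of_int d / real m)"
  have w: "cis (2 * pi * of_int (d * int t) / real m) = w ^ t" for t
    by (simp add: w_def Complex.DeMoivre algebra_simps)
  have w1: "w = 1 \<longleftrightarrow> int m dvd d"
  proof
    assume "w = 1"
    then have "cos (2 * pi * of_int d / real m) = 1"
      by (simp add: w_def complex_eq_iff)
    then obtain q :: int where "2 * pi * of_int d / real m = of_int q * 2 * pi"
      by (auto simp: cos_one_2pi_int)
    then have "of_int d = (of_int (q * int m) :: real)"
      using assms by (simp add: field_simps)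
    then have "d = q * int m"
      using of_int_eq_iff by blast
    then show "int m dvd d" by simp
  next
    assume "int m dvd d"
    then obtain q where "d = int m * q" ..
    then have "2 * pi * of_int d / real m = 2 * pi * of_int q"
      using assms by (simp add: field_simps)
    then have "w = cis (2 * pi * of_int q)"
      by (simp only: w_def)
    then show "w = 1" by (simp only: cis_multiple_2pi Ints_of_int)
  qed
  have wm: "w ^ m = 1"
    using assms by (simp add: w_def Complex.DeMoivre cis_multiple_2pi)
  show ?thesis
  proof (cases "w = 1")
    case False
    then show ?thesis using w1 wm geometric_sum[of w m] unfolding w by simp
  qed (use w1 w in auto)
qed

lemma norm_vilenkin_fun [simp]: "cmod (vilenkin_fun m n x) = 1"
  by (simp add: vilenkin_fun_def flip: prod_norm add: norm_power)

lemma gen_rademacher_measurable [measurable]: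
  "gen_rademacher m k \<in> borel_measurable (vilenkin_measure m)"
proof -
  have "(\<lambda>x. x k) \<in> measurable (vilenkin_measure m) (uniform_count_measure {..<m k})"
    unfolding vilenkin_measure_def by measurable
  moreover have "(\<lambda>t. exp (2 * of_real pi * \<i> * of_nat t / of_nat (m k)) :: complex)
      \<in> borel_measurable (uniform_count_measure {..<m k})"
    by (auto simp: measurable_def sets_uniform_count_measure space_uniform_count_measure)
  ultimately show ?thesis
    unfolding gen_rademacher_def[abs_def] by (rule measurable_compose)
qed

lemma vilenkin_fun_measurable [measurable]:
  "vilenkin_fun m n \<in> borel_measurable (vilenkin_measure m)"
  unfolding vilenkin_fun_def[abs_def] by measurable

context
  fixes m :: "nat \<Rightarrow> nat"
  assumes m2: "\<And>k. m k \<ge> 2"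
begin

lemma m_pos: "m k > 0"
  using m2[of k] by linarith

lemma gen_base_pos: "gen_base m k > 0"
  using less_gen_base[of m k, OF m2] by linarith

lemma gen_base_dvd: "i \<le> j \<Longrightarrow> gen_base m i dvd gen_base m j"
  unfolding gen_base_def by (intro prod_dvd_prod_subset) auto

lemma gen_base_mono: "i \<le> j \<Longrightarrow> gen_base m i \<le> gen_base m j"
  using gen_base_dvd gen_base_pos by (simp add: dvd_imp_le)

lemma double_gen_base_le: "2 * gen_base m k \<le> gen_base m (Suc k)"
  using m2[of k] by (simp add: gen_base_Suc)

lemma gen_digit_eq_0: "n < gen_base m N \<Longrightarrow> N \<le> k \<Longrightarrow> gen_digit m n k = 0"
  using gen_base_mono[of N k] by (simp add: gen_digit_def)

lemma vilenkin_fun_eq_prod: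
  assumes "n < gen_base m N"
  shows "vilenkin_fun m n x = (\<Prod>k<N. gen_rademacher m k x ^ gen_digit m n k)"
  unfolding vilenkin_fun_def
proof (rule prod.mono_neutral_left)
  show "{k. gen_digit m n k \<noteq> 0} \<subseteq> {..<N}"
    using gen_digit_eq_0[OF assms] by (metis (mono_tags) lessThan_iff mem_Collect_eq not_le subsetI)
qed auto

lemma gen_digit_add:
  assumes n: "n < gen_base m N" and j: "j < m N"
  shows "gen_digit m (n + j * gen_base m N) k = (if k < N then gen_digit m n k else if k = N then j else 0)"
proof (cases k N rule: linorder_cases)
  case less
  then have "gen_base m (Suc k) dvd gen_base m N"
    by (intro gen_base_dvd) simp
  then obtain q where "gen_base m N = gen_base m k * (m k * q)"
    by (auto simp: gen_base_Suc dvd_def mult_ac)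
  then have "n + j * gen_base m N = n + gen_base m k * (m k * (q * j))"
    by (simp add: mult_ac)
  then show ?thesis using less gen_base_pos[of k]
    by (simp only: gen_digit_def) simp
next
  case equal
  then show ?thesis using n j by (simp add: gen_digit_def)
next
  case greater
  have "n + j * gen_base m N < Suc j * gen_base m N" using n by simp
  also have "\<dots> \<le> gen_base m (Suc N)"
    unfolding gen_base_Suc using j by (intro mult_right_mono) auto
  finally show ?thesis using greater gen_digit_eq_0[of _ "Suc N" k] by simp
qed

lemma vilenkin_fun_add:
  assumes n: "n < gen_base m N" and j: "j < m N"
  shows "vilenkin_fun m (n + j * gen_base m N) x = vilenkin_fun m n x * gen_rademacher m N x ^ j"
proof -
  have "n + j * gen_base m N < Suc j * gen_base m N" using n by simp
  also have "\<dots> \<le> gen_base m (Suc N)"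
    unfolding gen_base_Suc using j by (intro mult_right_mono) auto
  finally show ?thesis
    using n j by (simp add: vilenkin_fun_eq_prod[of _ "Suc N"] vilenkin_fun_eq_prod[OF n] gen_digit_add)
qed

text \<open>
  The first \<open>M\<^sub>N\<close> Vilenkin functions span all functions of the first \<open>N\<close> coordinates. In the
  induction step the coordinate \<open>x\<^sub>N\<close> is fixed to a value \<open>t\<close>, which leaves a function of fewer
  coordinates, and the indicator of \<open>x\<^sub>N = t\<close> is expanded in powers of \<open>r\<^sub>N\<close>. A frequency
  \<open>n < M\<^sub>N\<^sub>+\<^sub>1\<close> is split as \<open>(n mod M\<^sub>N) + (n div M\<^sub>N) M\<^sub>N\<close>.
\<close>

lemma vilenkin_expansion:
  fixes F :: "(nat \<Rightarrow> nat) \<Rightarrow> complex"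
  assumes "\<And>x y. x \<in> vilenkin_group m \<Longrightarrow> y \<in> vilenkin_group m \<Longrightarrow>
    (\<And>k. k < N \<Longrightarrow> x k = y k) \<Longrightarrow> F x = F y"
  shows "\<exists>c. \<forall>x\<in>vilenkin_group m. F x = (\<Sum>n<gen_base m N. c n * vilenkin_fun m n x)"
  using assms
proof (induction N arbitrary: F)
  case 0
  have "F x = F (\<lambda>_. 0)" if "x \<in> vilenkin_group m" for x
    using that m_pos by (intro 0) (auto simp: vilenkin_group_def)
  then show ?case
    by (intro exI[of _ "\<lambda>_. F (\<lambda>_. 0)"]) (simp add: gen_base_0 vilenkin_fun_def gen_digit_def)
next
  case (Suc N)
  let ?G = "vilenkin_group m" and ?M = "gen_base m N"
  have upd: "x(N := t) \<in> ?G" if "x \<in> ?G" "t < m N" for x t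
    using that by (auto simp: vilenkin_group_def PiE_def extensional_def)
  have "\<exists>c. \<forall>x\<in>?G. F (x(N := t)) = (\<Sum>n<?M. c n * vilenkin_fun m n x)" if t: "t < m N" for t
    using t by (intro Suc.IH Suc.prems upd) (auto simp: less_Suc_eq)
  then obtain c where c: "\<And>t x. t < m N \<Longrightarrow> x \<in> ?G \<Longrightarrow>
      F (x(N := t)) = (\<Sum>n<?M. c t n * vilenkin_fun m n x)"
    by metis
  \<comment> \<open>the values at \<open>t\<close> of the conjugate characters, and the coefficients of the iterated expansion\<close>
  define e where "e j t = cis (2 * pi * of_int (- (int j * int t)) / real (m N))" for j t
  define C where "C n j = (\<Sum>t<m N. c t n * e j t) / of_nat (m N)" for n j
  have "F x = (\<Sum>n<gen_base m (Suc N). C (n mod ?M) (n div ?M) * vilenkin_fun m n x)" if x: "x \<in> ?G" for x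
  proof -
    have xN: "x N < m N" using x by (auto simp: vilenkin_group_def)
    have delta: "(\<Sum>j<m N. e j t * gen_rademacher m N x ^ j) =
        (if t = x N then of_nat (m N) else 0)" if t: "t < m N" for t
    proof -
      have "(\<Sum>j<m N. e j t * gen_rademacher m N x ^ j) =
          (\<Sum>j<m N. cis (2 * pi * of_int ((int (x N) - int t) * int j) / real (m N)))"
        unfolding rademacher_power_eq_cis e_def cis_mult
        by (intro sum.cong refl arg_cong[where f=cis])
           (simp add: algebra_simps diff_divide_distrib add_divide_distrib)
      also have "\<dots> = (if int (m N) dvd (int (x N) - int t) then of_nat (m N) else 0)"
        by (rule sum_cis_period[OF m_pos])
      also have "int (m N) dvd (int (x N) - int t) \<longleftrightarrow> t = x N"
        using t xN by (auto simp flip: mod_eq_dvd_iff)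
      finally show ?thesis .
    qed
    have block: "(\<Sum>n\<in>{j * ?M..<j * ?M + ?M}. C (n mod ?M) (n div ?M) * vilenkin_fun m n x)
        = (\<Sum>n<?M. C n j * (vilenkin_fun m n x * gen_rademacher m N x ^ j))" if "j < m N" for j
    proof -
      have "(\<Sum>n\<in>{j * ?M..<j * ?M + ?M}. C (n mod ?M) (n div ?M) * vilenkin_fun m n x)
          = (\<Sum>n\<in>{0..<?M}. C ((n + j * ?M) mod ?M) ((n + j * ?M) div ?M) * vilenkin_fun m (n + j * ?M) x)"
        using sum.shift_bounds_nat_ivl[of "\<lambda>n. C (n mod ?M) (n div ?M) * vilenkin_fun m n x" 0 "j * ?M" ?M]
        by (simp add: add.commute)
      also have "\<dots> = (\<Sum>n<?M. C n j * (vilenkin_fun m n x * gen_rademacher m N x ^ j))"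
        using that by (intro sum.cong) (auto simp: vilenkin_fun_add)
      finally show ?thesis .
    qed
    have "(\<Sum>n<gen_base m (Suc N). C (n mod ?M) (n div ?M) * vilenkin_fun m n x)
        = (\<Sum>j<m N. \<Sum>n\<in>{j * ?M..<j * ?M + ?M}. C (n mod ?M) (n div ?M) * vilenkin_fun m n x)"
      by (simp add: gen_base_Suc sum.nat_group)
    also have "\<dots> = (\<Sum>j<m N. \<Sum>n<?M. C n j * (vilenkin_fun m n x * gen_rademacher m N x ^ j))"
      by (rule sum.cong[OF refl]) (simp add: block)
    also have "\<dots> = (\<Sum>n<?M. vilenkin_fun m n x * (\<Sum>j<m N. C n j * gen_rademacher m N x ^ j))"
      by (subst sum.swap) (simp add: sum_distrib_left mult_ac)
    also have "\<dots> = (\<Sum>n<?M. vilenkin_fun m n x * c (x N) n)"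
    proof (intro sum.cong refl arg_cong2[where f="(*)"])
      fix n
      have "(\<Sum>j<m N. C n j * gen_rademacher m N x ^ j)
          = (\<Sum>t<m N. c t n / of_nat (m N) * (\<Sum>j<m N. e j t * gen_rademacher m N x ^ j))"
        unfolding C_def sum_distrib_left sum_distrib_right sum_divide_distrib
        by (subst sum.swap) (simp add: mult_ac)
      also have "\<dots> = (\<Sum>t<m N. if t = x N then c t n else 0)"
        using m_pos[of N] by (intro sum.cong refl) (simp add: delta)
      also have "\<dots> = c (x N) n" using xN by simp
      finally show "(\<Sum>j<m N. C n j * gen_rademacher m N x ^ j) = c (x N) n" .
    qed
    also have "\<dots> = F x"
      using c[OF xN x] by (simp add: mult.commute)
    finally show ?thesis by simp
  qed
  then show ?case
    by (intro exI[of _ "\<lambda>n. C (n mod ?M) (n div ?M)"] ballI)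
qed

text \<open>
  The integrand is a product of functions of single coordinates, only finitely many of them
  nonconstant, so the integral factorises into character sums over \<open>Z\<^bsub>m i\<^esub>\<close>. These vanish at
  any place where the digits of \<open>n\<close> and \<open>k\<close> differ.
\<close>

lemma vilenkin_orthonormal:
  "(LINT x|vilenkin_measure m. vilenkin_fun m n x * cnj (vilenkin_fun m k x)) = (if n = k then 1 else 0)"
proof -
  define L where "L = max n k"
  have nL: "n < gen_base m L" and kL: "k < gen_base m L"
    using less_gen_base[of m L, OF m2] by (auto simp: L_def)
  let ?u = "\<lambda>i. uniform_count_measure {..<m i}"
  have ne: "{..<m i} \<noteq> {}" for i using m_pos[of i] by blast
  interpret product_prob_space ?u UNIV
    by (intro product_prob_spaceI prob_space_uniform_count_measure ne) auto
  define g where "g i t = cis (2 * pi * of_int ((int (gen_digit m n i) - int (gen_digit m k i)) * int t) / real (m i))"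
    for i t
  have g: "vilenkin_fun m n x * cnj (vilenkin_fun m k x) = (\<Prod>i<L. g i (x i))" for x
    unfolding vilenkin_fun_eq_prod[OF nL] vilenkin_fun_eq_prod[OF kL] cnj_prod
    unfolding prod.distrib[symmetric] rademacher_power_eq_cis cis_cnj cis_mult g_def
    by (intro prod.cong refl arg_cong[where f=cis])
           (simp add: algebra_simps diff_divide_distrib add_divide_distrib)
  have gm: "g i \<in> borel_measurable (?u i)" for i
    by (auto simp: measurable_def sets_uniform_count_measure space_uniform_count_measure)
  have gi: "integrable (?u i) (g i)" for i
    by (auto simp: uniform_count_measure_def integrable_point_measure_finite)
  have "(LINT x|vilenkin_measure m. vilenkin_fun m n x * cnj (vilenkin_fun m k x))
      = (LINT x|vilenkin_measure m. (\<Prod>i<L. g i (restrict x {..<L} i)))"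
    by (simp add: g)
  also have "\<dots> = (LINT y|distr (Pi\<^sub>M UNIV ?u) (Pi\<^sub>M {..<L} ?u) (\<lambda>x. restrict x {..<L}). (\<Prod>i<L. g i (y i)))"
    unfolding vilenkin_measure_def
    by (subst integral_distr)
       (auto intro!: borel_measurable_prod measurable_compose[OF _ gm] measurable_component_singleton)
  also have "\<dots> = (LINT y|Pi\<^sub>M {..<L} ?u. (\<Prod>i<L. g i (y i)))"
    by (subst distr_PiM_restrict_finite) auto
  also have "\<dots> = (\<Prod>i<L. integral\<^sup>L (?u i) (g i))"
    using gi by (subst product_integral_prod) auto
  also have "\<dots> = (\<Prod>i<L. if gen_digit m n i = gen_digit m k i then 1 else 0)"
  proof (intro prod.cong refl)
    fix i
    have "integral\<^sup>L (?u i) (g i) =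
        (if int (m i) dvd (int (gen_digit m n i) - int (gen_digit m k i)) then of_nat (m i) else 0) / of_nat (m i)"
      unfolding sum_cis_period[OF m_pos, symmetric] g_def
      by (simp add: uniform_count_measure_def lebesgue_integral_point_measure_finite
          scaleR_conv_of_real sum_divide_distrib)
    also have "int (m i) dvd (int (gen_digit m n i) - int (gen_digit m k i)) \<longleftrightarrow> gen_digit m n i = gen_digit m k i"
      using gen_digit_less[of m n i, OF m2] gen_digit_less[of m k i, OF m2]
      by (auto simp flip: mod_eq_dvd_iff)
    finally show "integral\<^sup>L (?u i) (g i) = (if gen_digit m n i = gen_digit m k i then 1 else 0)"
      using m_pos[of i] by simp
  qed
  also have "\<dots> = (if n = k then 1 else 0)"
  proof (cases "n = k")
    case False
    have "\<exists>i<L. gen_digit m n i \<noteq> gen_digit m k i"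
    proof (rule ccontr)
      assume "\<not> ?thesis"
      then have "n mod gen_base m L = k mod gen_base m L"
        by (simp flip: sum_gen_digit_lessThan)
      then show False using False nL kL by simp
    qed
    then show ?thesis using False by (auto intro!: prod_zero)
  qed simp
  finally show ?thesis .
qed

section \<open>Fourier coefficients\<close>

lemma borel_measurable_cnj: "f \<in> borel_measurable M \<Longrightarrow> (\<lambda>x. cnj (f x)) \<in> borel_measurable M"
  by (rule borel_measurable_continuous_on[OF _ , of cnj f M]) (intro continuous_intros)

lemma vilenkin_coeff_polynomial:
  assumes "\<And>x. x \<in> vilenkin_group m \<Longrightarrow> F x = (\<Sum>j<K. c j * vilenkin_fun m j x)"
  shows "vilenkin_coeff m F n = (if n < K then c n else 0)"
proof -
  interpret prob_space "vilenkin_measure m" by (rule prob_space_vilenkin_measure[OF m2])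
  note [measurable] = borel_measurable_cnj
  have int: "integrable (vilenkin_measure m) (\<lambda>x. vilenkin_fun m j x * cnj (vilenkin_fun m n x))" for j
    by (rule integrable_const_bound[of _ 1]) (auto simp: norm_mult norm_vilenkin_fun)
  have "vilenkin_coeff m F n
      = (LINT x|vilenkin_measure m. (\<Sum>j<K. c j * (vilenkin_fun m j x * cnj (vilenkin_fun m n x))))"
    unfolding vilenkin_coeff_def
    by (intro Bochner_Integration.integral_cong)
       (simp_all add: assms space_vilenkin_measure sum_distrib_right mult.assoc)
  also have "\<dots> = (\<Sum>j<K. c j * (if j = n then 1 else 0))"
    using int by (subst Bochner_Integration.integral_sum) (auto simp: vilenkin_orthonormal)
  also have "\<dots> = (if n < K then c n else 0)" by (simp add: if_distrib cong: if_cong)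
  finally show ?thesis .
qed

text \<open>
  Vilenkin functions have modulus one, so dominated convergence applies to the series after
  multiplication by any of them.
\<close>

lemma vilenkin_coeff_sums:
  assumes int: "\<And>k. integrable (vilenkin_measure m) (P k)"
    and AE: "AE x in vilenkin_measure m. summable (\<lambda>k. norm (P k x))"
    and sum: "summable (\<lambda>k. LINT x|vilenkin_measure m. norm (P k x))"
  shows "(\<lambda>k. vilenkin_coeff m (P k) n) sums vilenkin_coeff m (\<lambda>x. \<Sum>k. P k x) n"
proof -
  let ?M = "vilenkin_measure m" and ?\<psi> = "\<lambda>x. cnj (vilenkin_fun m n x)"
  note [measurable] = borel_measurable_cnj borel_measurable_integrable[OF int]
  have nrm: "norm (P k x * ?\<psi> x) = norm (P k x)" for k x
    by (simp add: norm_mult norm_vilenkin_fun)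
  have "(\<lambda>k. LINT x|?M. P k x * ?\<psi> x) sums (LINT x|?M. (\<Sum>k. P k x * ?\<psi> x))"
  proof (rule sums_integral)
    show "integrable ?M (\<lambda>x. P k x * ?\<psi> x)" for k
      by (rule Bochner_Integration.integrable_bound[OF int[of k]]) (auto simp: nrm)
  qed (use AE sum in \<open>simp_all only: nrm\<close>)
  also have "(LINT x|?M. (\<Sum>k. P k x * ?\<psi> x)) = (LINT x|?M. (\<Sum>k. P k x) * ?\<psi> x)"
  proof (rule integral_cong_AE)
    show "AE x in ?M. (\<Sum>k. P k x * ?\<psi> x) = (\<Sum>k. P k x) * ?\<psi> x"
      using AE by eventually_elim (simp add: suminf_mult2 summable_norm_cancel)
  qed measurable
  finally show ?thesis by (simp add: vilenkin_coeff_def)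
qed

text \<open>
  The digit \<open>1\<close> in place \<open>N\<close> does not interact with the digits of a frequency below \<open>M\<^sub>N\<close>, so
  multiplication by \<open>r\<^sub>N\<close> translates the spectrum of the indicator function by \<open>M\<^sub>N\<close>.
\<close>

lemma rademacher_cylinder_expansion:
  assumes "cylinder m N U"
  shows "\<exists>c. (\<forall>n. n \<notin> {gen_base m N..<2 * gen_base m N} \<longrightarrow> c n = 0) \<and>
    (\<forall>x\<in>vilenkin_group m. gen_rademacher m N x * indicator U x
        = (\<Sum>n<2 * gen_base m N. c n * vilenkin_fun m n x))"
proof -
  let ?M = "gen_base m N"
  have "\<exists>a. \<forall>x\<in>vilenkin_group m. (indicator U x :: complex) = (\<Sum>n<?M. a n * vilenkin_fun m n x)"
  proof (rule vilenkin_expansion)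
    fix x y assume "x \<in> vilenkin_group m" "y \<in> vilenkin_group m" "\<And>k. k < N \<Longrightarrow> x k = y k"
    then have "x \<in> U \<longleftrightarrow> y \<in> U" by (rule cylinder_cong[OF assms])
    then show "(indicator U x :: complex) = indicator U y" by (simp add: indicator_def)
  qed
  then obtain a where a: "\<And>x. x \<in> vilenkin_group m \<Longrightarrow> indicator U x = (\<Sum>n<?M. a n * vilenkin_fun m n x)"
    by blast
  define c where "c n = (if n \<in> {?M..<2 * ?M} then a (n - ?M) else 0)" for n
  have "gen_rademacher m N x * indicator U x = (\<Sum>n<2 * ?M. c n * vilenkin_fun m n x)"
    if x: "x \<in> vilenkin_group m" for x
  proof -
    have "(\<Sum>n<2 * ?M. c n * vilenkin_fun m n x) = (\<Sum>n\<in>{?M..<2 * ?M}. c n * vilenkin_fun m n x)"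
      by (rule sum.mono_neutral_right) (auto simp: c_def)
    also have "\<dots> = (\<Sum>n<?M. c (n + ?M) * vilenkin_fun m (n + 1 * ?M) x)"
      using sum.shift_bounds_nat_ivl[of "\<lambda>n. c n * vilenkin_fun m n x" 0 ?M ?M]
      by (simp add: atLeast0LessThan mult_2)
    also have "\<dots> = (\<Sum>n<?M. a n * (vilenkin_fun m n x * gen_rademacher m N x ^ 1))"
    proof (rule sum.cong[OF refl])
      fix n assume "n \<in> {..<?M}"
      then show "c (n + ?M) * vilenkin_fun m (n + 1 * ?M) x
          = a n * (vilenkin_fun m n x * gen_rademacher m N x ^ 1)"
        using m2[of N] by (subst vilenkin_fun_add) (auto simp: c_def)
    qed
    also have "\<dots> = gen_rademacher m N x * indicator U x"
      by (simp add: a[OF x] sum_distrib_left mult_ac)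
    finally show ?thesis by simp
  qed
  then show ?thesis
    by (intro exI[of _ c]) (auto simp: c_def)
qed

section \<open>Fejer means of series with lacunary blocks\<close>

text \<open>
  Subtracting the sums of the first \<open>e\<close> and the first \<open>2 e\<close> partial sums leaves \<open>e\<close> copies of \<open>s\<close>.
  A gap in the spectrum as long as the part before it thus recovers a partial sum from two Fejer
  means.
\<close>

lemma partial_sum_from_fejer:
  assumes e: "e > 0" and const: "\<And>n. e < n \<Longrightarrow> n \<le> 2 * e \<Longrightarrow> vilenkin_partial_sum m n f x = s"
  shows "s = 2 * vilenkin_fejer m (2 * e) f x - vilenkin_fejer m e f x"
proof -
  let ?S = "\<lambda>n. vilenkin_partial_sum m n f x"
  have "{1..2*e} = {1..e} \<union> {e<..2*e}" by auto
  then have "(\<Sum>n=1..2*e. ?S n) = (\<Sum>n=1..e. ?S n) + (\<Sum>n\<in>{e<..2*e}. ?S n)"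
    by (simp only:) (rule sum.union_disjoint, auto)
  also have "(\<Sum>n\<in>{e<..2*e}. ?S n) = (\<Sum>n\<in>{e<..2*e}. s)"
    by (intro sum.cong) (auto simp: const)
  also have "\<dots> = of_nat e * s" by simp
  finally show ?thesis
    using e by (simp add: vilenkin_fejer_def field_simps)
qed

text \<open>
  The hypothesis on the coefficients says that \<open>f\<close> has the Fourier series of the sum of the blocks.
  Block \<open>k\<close> has its spectrum in \<open>[L, 2 * L)\<close> for \<open>L = gen_base m (N k)\<close>. As every \<open>m j\<close> is at
  least two, the distance two between consecutive \<open>N k\<close> makes the next block start at \<open>4 * L\<close> or
  later. The gap in between gives a partial sum of the blocks as a combination of two Fejer means.
\<close>

lemma fejer_diverges_of_lacunary_blocks:
  fixes N :: "nat \<Rightarrow> nat" and U :: "nat \<Rightarrow> (nat \<Rightarrow> nat) set" and f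
  defines "P \<equiv> \<lambda>k x. gen_rademacher m (N k) x * indicator (U k) x"
  assumes N: "\<And>k. N k + 2 \<le> N (Suc k)" and U: "\<And>k. cylinder m (N k) (U k)"
    and coeff: "\<And>n. (\<lambda>k. vilenkin_coeff m (P k) n) sums vilenkin_coeff m f n"
    and x: "x \<in> vilenkin_group m" and inf: "\<exists>\<^sub>\<infinity>k. x \<in> U k"
  shows "\<not> convergent (\<lambda>n. vilenkin_fejer m (Suc n) f x)"
proof
  assume "convergent (\<lambda>n. vilenkin_fejer m (Suc n) f x)"
  then obtain L where "(\<lambda>n. vilenkin_fejer m (Suc n) f x) \<longlonglongrightarrow> L"
    by (auto simp: convergent_def)
  then have L: "(\<lambda>n. vilenkin_fejer m n f x) \<longlonglongrightarrow> L"
    by (rule iffD1[OF filterlim_sequentially_Suc])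
  define e where "e k = 2 * gen_base m (N k)" for k
  have smN: "strict_mono N" unfolding strict_mono_Suc_iff
    using N by (metis Suc_le_lessD add_2_eq_Suc' Suc_leD)
  have e_step: "2 * e k \<le> gen_base m (N (Suc k))" for k
  proof -
    have "2 * e k \<le> 2 * gen_base m (Suc (N k))"
      using double_gen_base_le[of "N k"] by (simp add: e_def)
    also have "\<dots> \<le> gen_base m (Suc (Suc (N k)))" by (rule double_gen_base_le)
    also have "\<dots> \<le> gen_base m (N (Suc k))" using N[of k] by (intro gen_base_mono) simp
    finally show ?thesis .
  qed
  have e_pos: "e k > 0" for k using gen_base_pos[of "N k"] by (simp add: e_def)
  have sme: "strict_mono e"
    unfolding strict_mono_Suc_iff
  proof
    fix k show "e k < e (Suc k)" using e_step[of k] e_pos[of k] by (simp add: e_def)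
  qed
  have "\<forall>k. \<exists>c. (\<forall>n. n \<notin> {gen_base m (N k)..<e k} \<longrightarrow> c n = 0) \<and>
    (\<forall>x\<in>vilenkin_group m. P k x = (\<Sum>n<e k. c n * vilenkin_fun m n x))"
    unfolding P_def e_def using rademacher_cylinder_expansion[OF U] by blast
  then obtain c where c0: "\<And>k n. n \<notin> {gen_base m (N k)..<e k} \<Longrightarrow> c k n = 0"
    and c: "\<And>k x. x \<in> vilenkin_group m \<Longrightarrow> P k x = (\<Sum>n<e k. c k n * vilenkin_fun m n x)"
    by metis
  have Pc: "vilenkin_coeff m (P k) n = c k n" for k n
    using vilenkin_coeff_polynomial[where F = "P k" and K = "e k" and c = "c k" and n = n] c c0[of n k] by auto
  have partial: "vilenkin_partial_sum m n f x = (\<Sum>i\<le>k. P i x)"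
    if n: "e k < n" "n \<le> 2 * e k" for k n
  proof -
    have fhat: "vilenkin_coeff m f l = (\<Sum>i\<le>k. c i l)" if l: "l < n" for l
    proof -
      have "c i l = 0" if i: "i \<notin> {..k}" for i
      proof (rule c0)
        have "N (Suc k) \<le> N i" using i by (intro monoD[OF strict_mono_mono[OF smN]]) auto
        then have "gen_base m (N (Suc k)) \<le> gen_base m (N i)" by (rule gen_base_mono)
        then show "l \<notin> {gen_base m (N i)..<e i}" using l n e_step[of k] by auto
      qed
      then have "(\<lambda>i. c i l) sums (\<Sum>i\<le>k. c i l)" by (intro sums_finite) auto
      then show ?thesis using coeff[of l] sums_unique2 unfolding Pc by blast
    qed
    have "vilenkin_partial_sum m n f x = (\<Sum>l<n. \<Sum>i\<le>k. c i l * vilenkin_fun m l x)"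
      by (simp add: vilenkin_partial_sum_def fhat sum_distrib_right)
    also have "\<dots> = (\<Sum>i\<le>k. \<Sum>l<n. c i l * vilenkin_fun m l x)" by (rule sum.swap)
    also have "\<dots> = (\<Sum>i\<le>k. P i x)"
    proof (rule sum.cong[OF refl])
      fix i assume "i \<in> {..k}"
      then have "e i \<le> e k" using strict_mono_less_eq[OF sme] by simp
      then have "(\<Sum>l<n. c i l * vilenkin_fun m l x) = (\<Sum>l<e i. c i l * vilenkin_fun m l x)"
        using n c0[of _ i] by (intro sum.mono_neutral_right) auto
      then show "(\<Sum>l<n. c i l * vilenkin_fun m l x) = P i x" using c[OF x] by simp
    qed
    finally show ?thesis .
  qed
  have "(\<lambda>k. 2 * vilenkin_fejer m (2 * e k) f x - vilenkin_fejer m (e k) f x) \<longlonglongrightarrow> 2 * L - L"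
  proof (intro tendsto_intros)
    show "(\<lambda>k. vilenkin_fejer m (e k) f x) \<longlonglongrightarrow> L"
      using LIMSEQ_subseq_LIMSEQ[OF L sme] by (simp add: comp_def)
    have "strict_mono (\<lambda>k. 2 * e k)" using sme by (simp add: strict_mono_def)
    from LIMSEQ_subseq_LIMSEQ[OF L this]
    show "(\<lambda>k. vilenkin_fejer m (2 * e k) f x) \<longlonglongrightarrow> L" by (simp add: comp_def)
  qed
  also have "(\<lambda>k. 2 * vilenkin_fejer m (2 * e k) f x - vilenkin_fejer m (e k) f x) = (\<lambda>k. \<Sum>i\<le>k. P i x)"
    by (intro ext partial_sum_from_fejer[OF e_pos partial, symmetric])
  finally have "summable (\<lambda>i. P i x)"
    unfolding summable_def sums_def_le by blast
  then have "(\<lambda>i. norm (P i x)) \<longlonglongrightarrow> 0"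
    by (intro tendsto_norm_zero summable_LIMSEQ_zero)
  then have "eventually (\<lambda>i. norm (P i x) < 1) sequentially"
    by (rule order_tendstoD) simp
  then have "\<exists>\<^sub>\<infinity>i. x \<in> U i \<and> norm (P i x) < 1"
    using inf by (simp add: cofinite_eq_sequentially frequently_eventually_frequently)
  then obtain i where "x \<in> U i" "norm (P i x) < 1"
    using frequently_ex by blast
  then show False by (simp add: P_def norm_mult)
qed

end

section \<open>Divergence on a null set\<close>

theorem theorem1:
  fixes m :: "nat \<Rightarrow> nat" and p :: real and E :: "(nat \<Rightarrow> nat) set"
  assumes "\<And>k. m k \<ge> 2"
    and "1 \<le> p"
    and "E \<subseteq> vilenkin_group m"
    and "E \<in> null_sets (completion (vilenkin_measure m))"
  shows "\<exists>f \<in> vilenkin_Lp m p. \<forall>x\<in>E. \<not> convergent (\<lambda>n. vilenkin_fejer m (Suc n) f x)"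
proof -
  note m2 = assms(1)
  let ?M = "vilenkin_measure m"
  interpret prob_space ?M by (rule prob_space_vilenkin_measure[of m, OF m2])
  obtain X where X: "X \<in> null_sets ?M" "E \<subseteq> X"
    using assms(4)[unfolded null_sets_completion_iff2] by (elim bexE)
  \<comment> \<open>the decay that puts the series into \<open>L\<^sub>p\<close>, see \<open>thin_series_Lp\<close>\<close>
  define \<epsilon> where "\<epsilon> k = (1/2) ^ k / (real k + 1) powr p" for k
  have "\<exists>U. (\<forall>k. U k \<in> {A. \<exists>N. cylinder m N A} \<and> measure ?M (U k) \<le> \<epsilon> k) \<and> (\<forall>x\<in>X. \<exists>\<^sub>\<infinity>k. x \<in> U k)"
  proof (rule null_set_thin_limsup_cover[OF finite_measure_axioms _ _ X(1)])
    show "algebra (space ?M) {A. \<exists>N. cylinder m N A}"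
      unfolding space_vilenkin_measure by (rule algebra_cylinder)
    show "sets ?M = sigma_sets (space ?M) {A. \<exists>N. cylinder m N A}"
      unfolding space_vilenkin_measure by (rule sets_vilenkin_measure)
  qed (simp add: \<epsilon>_def)
  then obtain U where "\<forall>k. \<exists>N. cylinder m N (U k)" and small: "\<And>k. measure ?M (U k) \<le> \<epsilon> k"
    and inf: "\<And>x. x \<in> X \<Longrightarrow> \<exists>\<^sub>\<infinity>k. x \<in> U k" by blast
  then obtain N0 where N0: "\<And>k. cylinder m (N0 k) (U k)" by metis
  \<comment> \<open>A cylinder set also depends only on any longer initial segment of coordinates,
    so the numbers \<open>N0 k\<close> may be enlarged to make the blocks lacunary.\<close>
  define N where "N k = (\<Sum>i\<le>k. N0 i + 2)" for k
  have U: "cylinder m (N k) (U k)" for k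
  proof (rule cylinder_mono[OF N0])
    have "N0 k + 2 \<le> N k" unfolding N_def by (rule member_le_sum) auto
    then show "N0 k \<le> N k" by simp
  qed
  have N: "N k + 2 \<le> N (Suc k)" for k by (simp add: N_def)
  define P where "P k x = gen_rademacher m (N k) x * indicator (U k) x" for k x
  have meas: "P k \<in> borel_measurable ?M" for k
    unfolding P_def[abs_def]
    using gen_rademacher_measurable cylinder_measurable[OF U]
    by (simp add: borel_measurable_times borel_measurable_indicator)
  have bound: "cmod (P k x) \<le> indicator (U k) x" for k x
    by (simp add: P_def norm_mult indicator_def)
  have "p \<ge> 0" using assms(2) by simp
  note thin = thin_series_Lp[OF finite_measure_axioms this cylinder_measurable[OF U]
      small[unfolded \<epsilon>_def] meas bound]
  define f where "f x = (\<Sum>k. P k x)" for x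
  have "f \<in> vilenkin_Lp m p"
    using thin(4,5) by (simp add: vilenkin_Lp_def f_def[abs_def])
  moreover have "\<not> convergent (\<lambda>n. vilenkin_fejer m (Suc n) f x)" if "x \<in> E" for x
  proof (rule fejer_diverges_of_lacunary_blocks[of m, OF m2, of N U, OF N U])
    show "(\<lambda>k. vilenkin_coeff m (\<lambda>x. gen_rademacher m (N k) x * indicator (U k) x) n)
        sums vilenkin_coeff m f n" for n
      using vilenkin_coeff_sums[of m, OF m2, OF thin(1-3), of n] by (simp add: f_def[abs_def] P_def[abs_def])
  qed (use that assms(3) X(2) inf in auto)
  ultimately show ?thesis by blast
qed

end
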